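(* Let $n\geqslant 2$ and let $X,Y\in\mathfrak{su}(n)$ be elements each of which generates a knotted subgroup of $SU(n)$. If $X$ and $Y$ have the same list of eigenvalues (counted with multiplicity), then the knotted subgroup of $SU(n)$ generated by $X$ is ambient automorphic to the knotted subgroup generated by $Y$.
   Context: $\mathfrak{su}(n)$ is the Lie algebra of $SU(n)$: traceless skew-Hermitian $n\times n$ complex matrices. A knotted subgroup of a Lie group $G$ is a continuous injective group homomorphism $\gamma:S^1\to G$ with continuous inverse (defined on its image). For $X$ in the Lie algebra of $G$, the one-parameter subgroup generated by $X$ is $\phi_X:\mathbb{R}\to G$, $\phi_X(t)=e^{tX}$. The element $X$ generates a knotted subgroup if $\phi_X$ is nontrivial and non-injective; then $\ker\phi_X=\tau\mathbb{Z}$ for a unique $\tau>0$, and the knotted subgroup generated by $X$ is the induced map $S^1\cong\mathbb{R}/2\pi\mathbb{Z}\to G$, $s\mapsto\phi_X(\tau s/2\pi)$. Given knotted subgroups $\phi_1,\phi_2:S^1\to G$, an ambient automorphism from $\phi_1$ to $\phi_2$ is a continuous map $F:G\times[0,1]\to G$ such that, writing $F_t(A):=F(A,t)$: $F_0$ is the identity map on $G$; $F_t$ is both a homeomorphism and a group automorphism of $G$ for all $t\in[0,1]$; and $F_1\circ\phi_1=\phi_2$. In this case $\phi_1$ is said to be ambient automorphic to $\phi_2$. *)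

theory Defs
  imports "HOL-Analysis.Analysis" "HOL-Computational_Algebra.Computational_Algebra"
    "HOL-Algebra.Group"
begin

section \<open>Matrix notions\<close>

definition conj_transpose :: "complex ^ 'n ^ 'm \<Rightarrow> complex ^ 'm ^ 'n" where
  "conj_transpose A = (\<chi> i j. cnj (A $ j $ i))"

text \<open>
  Powers and exponentials are spelled out with \<^term>\<open>(**)\<close>, because multiplication and
  powers in the type class sense are componentwise on \<open>complex ^ 'n ^ 'n\<close>.
\<close>

primrec mat_power :: "complex ^ 'n ^ 'n \<Rightarrow> nat \<Rightarrow> complex ^ 'n ^ 'n" where
  "mat_power A 0 = mat 1"
| "mat_power A (Suc k) = A ** mat_power A k"

definition mat_exp :: "complex ^ 'n ^ 'n \<Rightarrow> complex ^ 'n ^ 'n" where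
  "mat_exp A = (\<Sum>k. (1 / fact k :: real) *\<^sub>R mat_power A k)"

definition charpoly :: "complex ^ 'n ^ 'n \<Rightarrow> complex poly" where
  "charpoly A = det (mat [:0, 1:] - (\<chi> i j. [:A $ i $ j:]))"

text \<open>The eigenvalues, counted with algebraic multiplicity.\<close>

definition eigenvalues :: "complex ^ 'n ^ 'n \<Rightarrow> complex multiset" where
  "eigenvalues A = proots (charpoly A)"

lemma poly_charpoly: "poly (charpoly A) x = det (mat x - A)"
proof -
  have "poly (mat [:0, 1:] $ i $ j - [:A $ i $ j:]) x = mat x $ i $ j - A $ i $ j" for i j
    by (simp add: mat_def)
  then show ?thesis
    by (simp add: charpoly_def det_def poly_sum poly_prod)
qed

lemma charpoly_nonzero: "charpoly A \<noteq> 0"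
proof
  assume "charpoly A = 0"
  then have "det (mat x - A) = 0" for x
    by (metis poly_charpoly poly_0)
  then have *: "\<exists>v. v \<noteq> 0 \<and> A *v v = x *s v" for x
  proof -
    have "\<not> invertible (mat x - A)"
      using \<open>det (mat x - A) = 0\<close> by (simp add: invertible_det_nz)
    then obtain v where v: "v \<noteq> 0" "(mat x - A) *v v = 0"
      by (meson invertible_left_inverse matrix_left_invertible_ker)
    have "mat x *v v = x *s v"
      by (simp add: vec_eq_iff matrix_vector_mult_def mat_def if_distrib if_distribR cong: if_cong)
    with v show ?thesis
      by (metis eq_iff_diff_eq_0 matrix_vector_mult_diff_rdistrib)
  qed
  define K where "K = (\<Sum>i\<in>UNIV. \<Sum>j\<in>UNIV. norm (A $ i $ j))"
  obtain v where v: "v \<noteq> 0" "A *v v = complex_of_real (K + 1) *s v"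
    using * by blast
  obtain i where i: "norm (v $ j) \<le> norm (v $ i)" for j
  proof -
    have "Max (range (\<lambda>j. norm (v $ j))) \<in> range (\<lambda>j. norm (v $ j))"
      by (intro Max_in) auto
    then obtain i where "Max (range (\<lambda>j. norm (v $ j))) = norm (v $ i)"
      by (metis (no_types, lifting) imageE)
    moreover have "norm (v $ j) \<le> Max (range (\<lambda>j. norm (v $ j)))" for j
      by (intro Max_ge) auto
    ultimately show ?thesis using that by metis
  qed
  have pos: "norm (v $ i) > 0"
  proof (rule ccontr)
    assume "\<not> ?thesis"
    then have "norm (v $ j) \<le> 0" for j using i[of j] by linarith
    then have "v = 0" by (simp add: vec_eq_iff)
    with v show False by simp
  qed
  have K0: "K \<ge> 0" by (simp add: K_def sum_nonneg)
  have "(K + 1) * norm (v $ i) = norm ((complex_of_real (K + 1) *s v) $ i)"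
    using K0 by (simp add: norm_mult del: of_real_add)
  also have "\<dots> = norm (\<Sum>j\<in>UNIV. A $ i $ j * v $ j)"
    using arg_cong[OF v(2), of "\<lambda>w. w $ i"] by (simp add: matrix_vector_mult_def)
  also have "\<dots> \<le> (\<Sum>j\<in>UNIV. norm (A $ i $ j) * norm (v $ i))"
    by (intro sum_norm_le) (simp add: norm_mult i mult_left_mono)
  also have "\<dots> = (\<Sum>j\<in>UNIV. norm (A $ i $ j)) * norm (v $ i)"
    by (simp add: sum_distrib_right)
  also have "\<dots> \<le> K * norm (v $ i)"
  proof (rule mult_right_mono)
    show "(\<Sum>j\<in>UNIV. norm (A $ i $ j)) \<le> K"
      unfolding K_def
      by (rule member_le_sum[of i UNIV "\<lambda>i. \<Sum>j\<in>UNIV. norm (A $ i $ j)"]) (auto intro: sum_nonneg)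
  qed simp
  finally show False using pos by (simp add: algebra_simps)
qed

lemma mem_eigenvalues_iff: "x \<in># eigenvalues A \<longleftrightarrow> (\<exists>v. v \<noteq> 0 \<and> A *v v = x *s v)"
proof -
  have mv: "mat x *v v = x *s v" for v :: "complex ^ 'a"
    by (simp add: vec_eq_iff matrix_vector_mult_def mat_def if_distrib if_distribR cong: if_cong)
  have "x \<in># eigenvalues A \<longleftrightarrow> \<not> invertible (mat x - A)"
    by (simp add: eigenvalues_def charpoly_nonzero poly_charpoly invertible_det_nz)
  also have "\<dots> \<longleftrightarrow> (\<exists>v. v \<noteq> 0 \<and> (mat x - A) *v v = 0)"
    by (metis invertible_left_inverse matrix_left_invertible_ker)
  also have "\<dots> \<longleftrightarrow> (\<exists>v. v \<noteq> 0 \<and> A *v v = x *s v)"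
    by (metis mv eq_iff_diff_eq_0 matrix_vector_mult_diff_rdistrib)
  finally show ?thesis .
qed


section \<open>The special unitary group and its Lie algebra\<close>

definition SU :: "(complex ^ 'n ^ 'n) monoid" where
  "SU = \<lparr>carrier = {A. conj_transpose A ** A = mat 1 \<and> det A = 1}, mult = (**), one = mat 1\<rparr>"

definition su :: "(complex ^ 'n ^ 'n) set" where
  "su = {X. conj_transpose X = - X \<and> trace X = 0}"

lemma conj_transpose_mult: "conj_transpose (A ** B) = conj_transpose B ** conj_transpose A"
  by (simp add: conj_transpose_def matrix_matrix_mult_def vec_eq_iff mult.commute)

lemma conj_transpose_conj_transpose [simp]: "conj_transpose (conj_transpose A) = A"
  by (simp add: conj_transpose_def vec_eq_iff)

lemma conj_transpose_one [simp]: "conj_transpose (mat 1) = mat 1"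
  by (simp add: conj_transpose_def vec_eq_iff mat_def)

lemma group_SU: "group SU"
proof (rule groupI)
  fix A B :: "complex ^ 'n ^ 'n"
  assume "A \<in> carrier SU" "B \<in> carrier SU"
  then have A: "conj_transpose A ** A = mat 1" "det A = 1"
    and B: "conj_transpose B ** B = mat 1" "det B = 1" by (auto simp: SU_def)
  have "conj_transpose (A ** B) ** (A ** B) = conj_transpose B ** (conj_transpose A ** A) ** B"
    by (simp add: conj_transpose_mult matrix_mul_assoc)
  then show "A \<otimes>\<^bsub>SU\<^esub> B \<in> carrier SU"
    using A B by (simp add: SU_def det_mul)
next
  fix A :: "complex ^ 'n ^ 'n"
  assume "A \<in> carrier SU"
  then have A: "conj_transpose A ** A = mat 1" "det A = 1" by (auto simp: SU_def)
  then have "A ** conj_transpose A = mat 1" by (simp add: matrix_left_right_inverse)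
  moreover have "det (conj_transpose A) = 1"
    using A det_mul[of "conj_transpose A" A] by simp
  ultimately show "\<exists>B\<in>carrier SU. B \<otimes>\<^bsub>SU\<^esub> A = \<one>\<^bsub>SU\<^esub>"
    using A by (intro bexI[of _ "conj_transpose A"]) (auto simp: SU_def)
qed (auto simp: SU_def matrix_mul_assoc)


section \<open>Knotted subgroups\<close>

definition circle_group :: "complex monoid" where
  "circle_group = \<lparr>carrier = sphere 0 1, mult = (*), one = 1\<rparr>"

text \<open>
  Topological groups are represented by a group structure whose carrier is a subset of a
  topological space, with the subspace topology.
\<close>

definition knotted_subgroup ::
    "('a::topological_space, 'b) monoid_scheme \<Rightarrow> (complex \<Rightarrow> 'a) \<Rightarrow> bool" where
  "knotted_subgroup G \<gamma> \<longleftrightarrow>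
     \<gamma> \<in> hom circle_group G \<and>
     continuous_on (sphere 0 1) \<gamma> \<and>
     inj_on \<gamma> (sphere 0 1) \<and>
     continuous_on (\<gamma> ` sphere 0 1) (inv_into (sphere 0 1) \<gamma>)"

definition one_param :: "complex ^ 'n ^ 'n \<Rightarrow> real \<Rightarrow> complex ^ 'n ^ 'n" where
  "one_param X t = mat_exp (t *\<^sub>R X)"

definition generates_knotted_subgroup :: "complex ^ 'n ^ 'n \<Rightarrow> bool" where
  "generates_knotted_subgroup X \<longleftrightarrow> (\<exists>t. one_param X t \<noteq> mat 1) \<and> \<not> inj (one_param X)"

definition period :: "complex ^ 'n ^ 'n \<Rightarrow> real" where
  "period X = (THE \<tau>. \<tau> > 0 \<and> {t. one_param X t = mat 1} = range (\<lambda>k::int. \<tau> * of_int k))"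

text \<open>
  The circle is the unit circle in the complex plane, identified with the reals modulo
  \<open>2 * pi\<close> via \<^const>\<open>cis\<close>; \<^term>\<open>Arg2pi z\<close> is the representative of \<open>z\<close> in \<open>[0, 2 * pi)\<close>.
\<close>

definition generated_knotted_subgroup :: "complex ^ 'n ^ 'n \<Rightarrow> complex \<Rightarrow> complex ^ 'n ^ 'n" where
  "generated_knotted_subgroup X z = one_param X (period X * Arg2pi z / (2 * pi))"

definition ambient_automorphism ::
    "('a::topological_space, 'b) monoid_scheme \<Rightarrow> ('a \<times> real \<Rightarrow> 'a)
      \<Rightarrow> (complex \<Rightarrow> 'a) \<Rightarrow> (complex \<Rightarrow> 'a) \<Rightarrow> bool" where
  "ambient_automorphism G F \<phi>\<^sub>1 \<phi>\<^sub>2 \<longleftrightarrow>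
     F \<in> carrier G \<times> {0..1} \<rightarrow> carrier G \<and>
     continuous_on (carrier G \<times> {0..1}) F \<and>
     (\<forall>A\<in>carrier G. F (A, 0) = A) \<and>
     (\<forall>t\<in>{0..1}. (\<exists>H. homeomorphism (carrier G) (carrier G) (\<lambda>A. F (A, t)) H) \<and>
                  (\<lambda>A. F (A, t)) \<in> iso G G) \<and>
     (\<forall>z\<in>sphere 0 1. F (\<phi>\<^sub>1 z, 1) = \<phi>\<^sub>2 z)"

text \<open>The relation is only meaningful between knotted subgroups, so this is part of it.\<close>

definition ambient_automorphic ::
    "('a::topological_space, 'b) monoid_scheme \<Rightarrow> (complex \<Rightarrow> 'a) \<Rightarrow> (complex \<Rightarrow> 'a) \<Rightarrow> bool" where
  "ambient_automorphic G \<phi>\<^sub>1 \<phi>\<^sub>2 \<longleftrightarrow>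
     knotted_subgroup G \<phi>\<^sub>1 \<and> knotted_subgroup G \<phi>\<^sub>2 \<and>
     (\<exists>F. ambient_automorphism G F \<phi>\<^sub>1 \<phi>\<^sub>2)"

end

theory Submission
  imports Defs "HOL-Combinatorics.Permutations"
begin

text \<open>
  Elements \<open>X\<close> and \<open>Y\<close> of the Lie algebra are skew-Hermitian, hence normal, so the spectral theorem
  gives each of them an orthonormal basis of eigenvectors
  (\<open>normal_matrix_unitarily_diagonalizable\<close>). If their eigenvalues agree with multiplicity, then
  matching up the two bases gives a unitary matrix \<open>U\<close> with \<open>Y = U X U\<^sup>*\<close>
  (\<open>normal_matrices_unitarily_similar\<close>). Exponentials are compatible with conjugation, so
  the one-parameter subgroups of \<open>X\<close> and \<open>Y\<close> are conjugate under \<open>U\<close> at equal times. In particular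
  they have the same kernel and the same period, and conjugation by \<open>U\<close> takes the knotted subgroup
  generated by \<open>X\<close> to the one generated by \<open>Y\<close> with its parametrization.

  It remains to deform this conjugation to the identity through automorphisms. The spectral theorem
  applied to \<open>U\<close> itself provides a path of unitary matrices from the identity to \<open>U\<close>
  (\<open>unitary_path_from_identity\<close>), and conjugations by the matrices on the path are automorphisms
  and homeomorphisms of the special unitary group
  (\<open>ambient_automorphism_of_unitary_conjugation\<close>).

  The relation also asks that both maps be knotted subgroups. Diagonalization turns a one-parameter
  subgroup into simultaneous rotations of the eigenvectors. When it is nontrivial and not injective,
  its kernel is a nonzero discrete subgroup of the reals, so it is generated by the period; measured
  in the period, all rotation numbers are integers, and the map on the circle is given by powers
  of \<open>z\<close> (\<open>generated_knotted_subgroup_knotted\<close>).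
\<close>

(* The infix dollar sign below always selects a component of a vector. *)
no_notation fps_nth (infixl "$" 75)

section \<open>Normal matrices and the Hermitian inner product\<close>

definition hinner :: "complex ^ 'n \<Rightarrow> complex ^ 'n \<Rightarrow> complex" where
  "hinner x y = (\<Sum>i\<in>UNIV. x $ i * cnj (y $ i))"

definition normal_matrix :: "complex ^ 'n ^ 'n \<Rightarrow> bool" where
  "normal_matrix N \<longleftrightarrow> N ** conj_transpose N = conj_transpose N ** N"

lemma hinner_scale_left: "hinner (c *s x) y = c * hinner x y"
  by (simp add: hinner_def sum_distrib_left mult.assoc)

lemma hinner_scale_right: "hinner x (c *s y) = cnj c * hinner x y"
  by (simp add: hinner_def sum_distrib_left mult_ac)

lemma hinner_commute: "hinner y x = cnj (hinner x y)"
  by (simp add: hinner_def mult.commute)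

lemma hinner_self: "hinner x x = of_real ((norm x)\<^sup>2)"
  by (simp add: hinner_def norm_vec_def L2_set_def complex_norm_square[symmetric] sum_nonneg)

lemma hinner_adjoint: "hinner (A *v x) y = hinner x (conj_transpose A *v y)"
  unfolding hinner_def matrix_vector_mult_def conj_transpose_def
  by (simp add: sum_distrib_left sum_distrib_right mult_ac) (rule sum.swap)

lemma mat_mult_vector: "mat c *v v = c *s (v :: complex ^ 'n)"
  by (simp add: vec_eq_iff matrix_vector_mult_def mat_def if_distrib if_distribR cong: if_cong)

lemma conj_transpose_diff: "conj_transpose (A - B) = conj_transpose A - conj_transpose B"
  by (simp add: conj_transpose_def vec_eq_iff)

lemma conj_transpose_mat: "conj_transpose (mat c) = mat (cnj c)"
  by (simp add: conj_transpose_def vec_eq_iff mat_def)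

lemma normal_matrix_norm_adjoint:
  assumes "normal_matrix M"
  shows "norm (conj_transpose M *v v) = norm (M *v v)"
proof -
  have "hinner (conj_transpose M *v v) (conj_transpose M *v v) = hinner (M *v v) (M *v v)"
    using assms hinner_adjoint[of M v "M *v v"] hinner_adjoint[of "conj_transpose M" v "conj_transpose M *v v"]
    by (simp add: matrix_vector_mul_assoc normal_matrix_def)
  then have "(norm (conj_transpose M *v v))\<^sup>2 = (norm (M *v v))\<^sup>2"
    unfolding hinner_self of_real_eq_iff .
  then show ?thesis by simp
qed

lemma matrix_mult_mat:
  "A ** mat c = (\<chi> i j. c * A $ i $ j)" "mat c ** A = (\<chi> i j. c * A $ i $ j)"
  for A :: "complex ^ 'n ^ 'n"
  by (simp_all add: vec_eq_iff matrix_matrix_mult_def mat_def if_distrib if_distribR mult.commute cong: if_cong)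

lemma matrix_mult_diff:
  "A ** (B - C) = A ** B - A ** C" "(B - C) ** A = B ** A - C ** A"
  for A :: "complex ^ 'n ^ 'n"
  by (simp_all add: vec_eq_iff matrix_matrix_mult_def algebra_simps sum_subtractf)

lemma normal_matrix_shift:
  assumes "normal_matrix N"
  shows "normal_matrix (N - mat c)"
  using assms unfolding normal_matrix_def
  by (simp add: conj_transpose_diff conj_transpose_mat matrix_mult_diff matrix_mult_mat)
    (simp add: mat_def vec_eq_iff fun_eq_iff algebra_simps)

text \<open>
  The matrix \<open>N - mat c\<close> is normal too, so it and its adjoint \<open>N\<^sup>* - mat (cnj c)\<close> have the same
  kernel, because they are equally long on every vector.
\<close>

lemma normal_matrix_adjoint_eigenvector:
  assumes "normal_matrix N" "N *v v = c *s v"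
  shows "conj_transpose N *v v = cnj c *s v"
proof -
  have "norm (conj_transpose (N - mat c) *v v) = norm ((N - mat c) *v v)"
    by (intro normal_matrix_norm_adjoint normal_matrix_shift assms)
  also have "\<dots> = 0"
    using assms(2) by (simp add: matrix_vector_mult_diff_rdistrib mat_mult_vector)
  finally show ?thesis
    by (simp add: conj_transpose_diff conj_transpose_mat matrix_vector_mult_diff_rdistrib mat_mult_vector)
qed

section \<open>Eigenvectors in invariant subspaces\<close>

text \<open>
  A convenient form of the statement that fewer linear equations than unknowns have a nonzero
  solution: the missing equations are filled up with zero rows.
\<close>

lemma zero_row_kernel:
  fixes A :: "complex ^ 'n ^ 'n"
  assumes "A $ k = 0"
  obtains v where "v \<noteq> 0" "A *v v = 0"
proof -
  have "row k A = 0" using assms by (simp add: row_def vec_eq_iff)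
  then have "\<not> invertible A"
    using det_zero_row(2) invertible_det_nz by blast
  then show ?thesis
    using that by (metis invertible_left_inverse matrix_left_invertible_ker)
qed

text \<open>
  The vector \<open>p(N) v\<close>, evaluated by the Horner scheme. It is not \<^term>\<open>poly\<close> at a matrix,
  which would multiply matrices componentwise.
\<close>

definition poly_act :: "complex ^ 'n ^ 'n \<Rightarrow> complex poly \<Rightarrow> complex ^ 'n \<Rightarrow> complex ^ 'n" where
  "poly_act N p v = fold_coeffs (\<lambda>a u. a *s v + N *v u) p 0"

lemma poly_act_0 [simp]: "poly_act N 0 v = 0"
  by (simp add: poly_act_def)

lemma poly_act_pCons [simp]: "poly_act N (pCons a p) v = a *s v + N *v poly_act N p v"
  by (cases "p = 0 \<and> a = 0") (auto simp: poly_act_def)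

lemma poly_act_add: "poly_act N (p + q) v = poly_act N p v + poly_act N q v"
proof (induction p arbitrary: q)
  case (pCons a p)
  then show ?case
    by (cases q) (simp add: matrix_vector_right_distrib vec.scale_left_distrib)
qed simp

lemma poly_act_smult: "poly_act N (smult c p) v = c *s poly_act N p v"
proof (induction p)
  case (pCons a p)
  have "N *v (c *s u) = c *s (N *v u)" for u
    by (simp add: vector_scalar_commute)
  with pCons show ?case
    by (simp add: vec.scale_right_distrib)
qed simp

lemma poly_act_sum: "poly_act N (\<Sum>i\<in>I. f i) v = (\<Sum>i\<in>I. poly_act N (f i) v)"
  by (induction I rule: infinite_finite_induct) (simp_all add: poly_act_add)

lemma poly_act_linear_factor:
  "poly_act N ([:- r, 1:] * q) v = N *v poly_act N q v - r *s poly_act N q v"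
proof -
  have "[:- r, 1:] * q = pCons 0 q + smult (- r) q" by simp
  then show ?thesis
    by (simp only: poly_act_add poly_act_smult poly_act_pCons) simp
qed

text \<open>
  The vectors \<open>N\<^sup>k w\<close> for \<open>n + 1\<close> different exponents \<open>k\<close> are linearly dependent in dimension
  \<open>n\<close>. The index type with \<open>n + 1\<close> elements is \<open>'n option\<close>: the matrix whose columns are these
  vectors becomes square by adding a zero row at \<^const>\<open>None\<close>, and a vector in its kernel lists
  the coefficients of the polynomial.
\<close>

lemma annihilating_poly_exists:
  fixes N :: "complex ^ 'n ^ 'n"
  obtains p where "p \<noteq> 0" "poly_act N p w = 0"
proof -
  obtain e :: "'n option \<Rightarrow> nat" where e: "inj e"
    using finite_imp_inj_to_nat_seg[of "UNIV :: 'n option set"] by auto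
  define A :: "complex ^ 'n option ^ 'n option" where
    "A = (\<chi> i j. case i of None \<Rightarrow> 0 | Some i' \<Rightarrow> poly_act N (monom 1 (e j)) w $ i')"
  have "A $ None = 0"
    by (simp add: A_def vec_eq_iff)
  then obtain c where c: "c \<noteq> 0" "A *v c = 0"
    by (rule zero_row_kernel)
  define p where "p = (\<Sum>j\<in>UNIV. smult (c $ j) (monom 1 (e j)))"
  have coeff_p: "coeff p (e j) = c $ j" for j
  proof -
    have "coeff p (e j) = (\<Sum>i\<in>UNIV. if i = j then c $ j else 0)"
      unfolding p_def coeff_sum by (intro sum.cong) (auto simp: inj_eq[OF e])
    then show ?thesis by simp
  qed
  have "p \<noteq> 0"
  proof
    assume "p = 0"
    then have "c $ j = 0" for j using coeff_p[of j] by simp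
    then show False using c(1) by (simp add: vec_eq_iff)
  qed
  moreover have "poly_act N p w $ i = (A *v c) $ Some i" for i
    by (simp add: p_def poly_act_sum poly_act_smult A_def matrix_vector_mult_def mult.commute)
  then have "poly_act N p w = 0"
    by (simp add: c(2) vec_eq_iff)
  ultimately show ?thesis by (rule that)
qed

text \<open>
  If \<open>p\<close> has least degree among the nonzero polynomials with \<open>p(N) w = 0\<close>, and \<open>r\<close> is a root of
  \<open>p = (x - r) q\<close>, then \<open>q(N) w\<close> is nonzero and \<open>N - r\<close> kills it. It lies in the subspace
  because it is a combination of the vectors \<open>N\<^sup>k w\<close>.
\<close>

lemma eigenvector_in_invariant_subspace:
  fixes N :: "complex ^ 'n ^ 'n"
  assumes W: "vec.subspace W" "\<And>v. v \<in> W \<Longrightarrow> N *v v \<in> W"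
    and w: "w \<in> W" "w \<noteq> 0"
  obtains v c where "v \<in> W" "v \<noteq> 0" "N *v v = c *s v"
proof -
  obtain p0 where "p0 \<noteq> 0 \<and> poly_act N p0 w = 0"
    using annihilating_poly_exists by metis
  then obtain p where p: "p \<noteq> 0" "poly_act N p w = 0"
    and min: "\<And>q. q \<noteq> 0 \<Longrightarrow> poly_act N q w = 0 \<Longrightarrow> degree p \<le> degree q"
    using ex_has_least_nat[of "\<lambda>p. p \<noteq> 0 \<and> poly_act N p w = 0" p0 degree] by metis
  have "degree p > 0"
  proof (rule ccontr)
    assume "\<not> ?thesis"
    then obtain a where "p = [:a:]" by (metis degree_eq_zeroE neq0_conv)
    with p w show False by simp
  qed
  then obtain r where "poly p r = 0"
    using alg_closed_imp_poly_has_root by blast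
  then obtain q where q: "p = [:- r, 1:] * q"
    unfolding poly_eq_0_iff_dvd by (rule dvdE)
  have "q \<noteq> 0" using p(1) q by auto
  then have "degree q < degree p" unfolding q by (subst degree_mult_eq) auto
  then have "poly_act N q w \<noteq> 0"
    using min[OF \<open>q \<noteq> 0\<close>] by linarith
  moreover have "poly_act N q w \<in> W" for q
    by (induction q) (auto intro!: vec.subspace_add vec.subspace_scale W w vec.subspace_0)
  moreover have "N *v poly_act N q w = r *s poly_act N q w"
    using p(2) unfolding q poly_act_linear_factor by simp
  ultimately show ?thesis using that by blast
qed

section \<open>Unitary diagonalization\<close>

text \<open>
  An orthonormal family of eigenvectors indexed by a proper subset \<open>S\<close> of the coordinates can be
  extended by one more index. The orthogonal complement \<open>W\<close> of the family is nonzero because it is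
  given by fewer equations than unknowns, and \<open>N\<close> maps it to itself because the members of the
  family are eigenvectors of the adjoint as well. So \<open>W\<close> contains a further eigenvector.
\<close>

lemma normal_matrix_orthonormal_eigenvectors:
  fixes N :: "complex ^ 'n ^ 'n" and S :: "'n set"
  assumes "normal_matrix N"
  shows "\<exists>v d. (\<forall>i\<in>S. N *v v i = d i *s v i) \<and>
               (\<forall>i\<in>S. \<forall>j\<in>S. hinner (v i) (v j) = (if i = j then 1 else 0))"
proof (induction S rule: finite_induct[OF finite])
  case (2 k S)
  then obtain v d where v: "\<And>i. i \<in> S \<Longrightarrow> N *v v i = d i *s v i"
    and orth: "\<And>i j. i \<in> S \<Longrightarrow> j \<in> S \<Longrightarrow> hinner (v i) (v j) = (if i = j then 1 else 0)"
    by blast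
  define W where "W = {w. \<forall>i\<in>S. hinner w (v i) = 0}"
  define A :: "complex ^ 'n ^ 'n" where "A = (\<chi> i j. if i \<in> S then cnj (v i $ j) else 0)"
  have "A $ k = 0" using 2 by (simp add: A_def vec_eq_iff)
  then obtain w where w: "w \<noteq> 0" "A *v w = 0" by (rule zero_row_kernel)
  have "hinner w (v i) = (A *v w) $ i" if "i \<in> S" for i
    using that by (simp add: A_def matrix_vector_mult_def hinner_def mult.commute)
  then have "w \<in> W" using w by (simp add: W_def)
  have sub: "vec.subspace W"
    unfolding vec.subspace_def W_def
    by (auto simp: hinner_scale_left) (simp_all add: hinner_def algebra_simps sum.distrib)
  have inv: "N *v u \<in> W" if "u \<in> W" for u
    using that
    by (simp add: W_def hinner_adjoint normal_matrix_adjoint_eigenvector[OF assms v] hinner_scale_right)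
  obtain u c where u: "u \<in> W" "u \<noteq> 0" "N *v u = c *s u"
    using eigenvector_in_invariant_subspace[OF sub inv \<open>w \<in> W\<close> w(1)] by blast
  define u' where "u' = complex_of_real (1 / norm u) *s u"
  have "hinner u' u' = of_real (1 / norm u) * (of_real (1 / norm u) * hinner u u)"
    by (simp add: u'_def hinner_scale_left hinner_scale_right)
  then have "hinner u' u' = 1"
    using u(2) by (simp add: hinner_self power2_eq_square)
  moreover have "N *v u' = c *s u'"
    by (simp add: u'_def vector_scalar_commute u(3) mult.commute)
  moreover have "u' \<in> W"
    unfolding u'_def using sub u(1) by (rule vec.subspace_scale)
  then have "hinner u' (v i) = 0" "hinner (v i) u' = 0" if "i \<in> S" for i
    using that hinner_commute[of "v i" u'] by (auto simp: W_def)
  moreover have "i \<noteq> k" if "i \<in> S" for i using that 2 by blast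
  ultimately show ?case
    by (intro exI[of _ "v(k := u')"] exI[of _ "d(k := c)"]) (auto simp: v orth)
qed simp

definition unitary :: "complex ^ 'n ^ 'n \<Rightarrow> bool" where
  "unitary U \<longleftrightarrow> conj_transpose U ** U = mat 1"

definition diag_matrix :: "('n \<Rightarrow> complex) \<Rightarrow> complex ^ 'n ^ 'n" where
  "diag_matrix d = (\<chi> i j. if i = j then d i else 0)"

lemma diag_matrix_one: "diag_matrix (\<lambda>_. 1) = mat 1"
  by (simp add: diag_matrix_def mat_def)

lemma conj_transpose_diag_matrix: "conj_transpose (diag_matrix d) = diag_matrix (\<lambda>i. cnj (d i))"
  by (auto simp: diag_matrix_def conj_transpose_def vec_eq_iff)

text \<open>
  For unitary \<open>V\<close> this matrix has the columns of \<open>V\<close> as eigenvectors, with the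
  eigenvalues \<open>d\<close>. For a fixed \<open>V\<close>, functions of such matrices are computed on the
  eigenvalues.
\<close>

definition conj_diag :: "complex ^ 'n ^ 'n \<Rightarrow> ('n \<Rightarrow> complex) \<Rightarrow> complex ^ 'n ^ 'n" where
  "conj_diag V d = V ** diag_matrix d ** conj_transpose V"

lemma unitary_right: "unitary U \<Longrightarrow> U ** conj_transpose U = mat 1"
  by (simp add: unitary_def matrix_left_right_inverse)

lemma unitary_mult:
  assumes "unitary U" "unitary V"
  shows "unitary (U ** V)"
proof -
  have "conj_transpose (U ** V) ** (U ** V) = conj_transpose V ** (conj_transpose U ** U) ** V"
    by (simp add: conj_transpose_mult matrix_mul_assoc)
  then show ?thesis
    using assms by (simp add: unitary_def)
qed

lemma unitary_conj_transpose: "unitary U \<Longrightarrow> unitary (conj_transpose U)"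
  using unitary_right by (simp add: unitary_def)

lemma unitary_imp_normal: "unitary U \<Longrightarrow> normal_matrix U"
  by (simp add: normal_matrix_def unitary_right) (simp add: unitary_def)

lemma skew_hermitian_imp_normal: "conj_transpose X = - X \<Longrightarrow> normal_matrix X"
  by (simp add: normal_matrix_def vec_eq_iff matrix_matrix_mult_def)

lemma unitary_cancel:
  assumes "unitary V"
  shows "A ** conj_transpose V ** V = A" and "A ** V ** conj_transpose V = A"
proof -
  note * = assms[unfolded unitary_def] unitary_right[OF assms]
  show "A ** conj_transpose V ** V = A" "A ** V ** conj_transpose V = A"
    by (simp_all only: matrix_mul_assoc[symmetric] * matrix_mul_rid)
qed

lemma conj_diag_entry:
  "conj_diag V d $ i $ j = (\<Sum>l\<in>UNIV. V $ i $ l * d l * cnj (V $ j $ l))"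
  by (simp add: conj_diag_def diag_matrix_def matrix_matrix_mult_def conj_transpose_def if_distrib if_distribR
      cong: if_cong)

lemma conj_diag_one: "unitary V \<Longrightarrow> conj_diag V (\<lambda>_. 1) = mat 1"
  by (simp add: conj_diag_def diag_matrix_one unitary_right)

lemma conj_diag_mult:
  assumes "unitary V"
  shows "conj_diag V c ** conj_diag V d = conj_diag V (\<lambda>i. c i * d i)"
proof -
  have "(\<Sum>k\<in>UNIV. (if i = k then c i else 0) * (if k = j then d k else 0))
      = (\<Sum>k\<in>UNIV. if k = i then (if i = j then c i * d i else 0) else 0)" for i j
    by (intro sum.cong) auto
  then have "diag_matrix c ** diag_matrix d = diag_matrix (\<lambda>i. c i * d i)"
    by (simp add: diag_matrix_def vec_eq_iff matrix_matrix_mult_def)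
  from this[symmetric] show ?thesis
    by (simp add: conj_diag_def matrix_mul_assoc unitary_cancel(1)[OF assms])
qed

lemma conj_diag_inject:
  assumes "unitary V"
  shows "conj_diag V c = conj_diag V d \<longleftrightarrow> c = d"
proof
  assume "conj_diag V c = conj_diag V d"
  then have "conj_transpose V ** conj_diag V c ** V = conj_transpose V ** conj_diag V d ** V"
    by simp
  moreover have "conj_transpose V ** conj_diag V f ** V = diag_matrix f" for f
    unfolding conj_diag_def matrix_mul_assoc unitary_cancel[OF assms] assms[unfolded unitary_def]
    by simp
  ultimately have "diag_matrix c $ k $ k = diag_matrix d $ k $ k" for k
    by simp
  then show "c = d"
    by (simp add: fun_eq_iff diag_matrix_def)
qed simp

lemma conj_diag_eq_one_iff:
  assumes "unitary V"
  shows "conj_diag V d = mat 1 \<longleftrightarrow> (\<forall>i. d i = 1)"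
  using conj_diag_inject[OF assms, of d "\<lambda>_. 1"] by (simp add: conj_diag_one[OF assms] fun_eq_iff)

lemma conj_transpose_conj_diag: "conj_transpose (conj_diag V d) = conj_diag V (\<lambda>i. cnj (d i))"
  by (simp add: conj_diag_def conj_transpose_mult conj_transpose_diag_matrix matrix_mul_assoc)

lemma conj_diag_conjugate: "U ** conj_diag V d ** conj_transpose U = conj_diag (U ** V) d"
  by (simp add: conj_diag_def conj_transpose_mult matrix_mul_assoc)

lemma det_conj_diag:
  assumes "unitary V"
  shows "det (conj_diag V d) = (\<Prod>i\<in>UNIV. d i)"
proof -
  have "det (conj_transpose V) * det V = 1"
    using assms by (metis unitary_def det_mul det_I)
  moreover have "det (diag_matrix d) = (\<Prod>i\<in>UNIV. d i)"
    by (subst det_diagonal) (auto simp: diag_matrix_def)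
  ultimately show ?thesis
    by (simp add: conj_diag_def det_mul mult_ac)
qed

lemma trace_conj_diag:
  assumes "unitary V"
  shows "trace (conj_diag V d) = (\<Sum>i\<in>UNIV. d i)"
proof -
  have "trace (conj_diag V d) = trace (conj_transpose V ** V ** diag_matrix d)"
    by (metis conj_diag_def trace_mul_sym matrix_mul_assoc)
  then show ?thesis
    using assms by (simp add: unitary_def trace_def diag_matrix_def)
qed

lemma unitary_conj_diag:
  assumes "unitary V" "\<And>i. norm (d i) = 1"
  shows "unitary (conj_diag V d)"
proof -
  have "cnj (d i) * d i = 1" for i
    using assms(2)[of i] complex_norm_square[of "d i"] by (simp add: mult.commute)
  then show ?thesis
    by (simp add: unitary_def conj_transpose_conj_diag conj_diag_mult[OF assms(1)] conj_diag_one[OF assms(1)])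
qed

theorem normal_matrix_unitarily_diagonalizable:
  fixes N :: "complex ^ 'n ^ 'n"
  assumes "normal_matrix N"
  obtains V d where "unitary V" "N = conj_diag V d"
proof -
  obtain v :: "'n \<Rightarrow> complex ^ 'n" and d where vd: "(\<forall>i\<in>UNIV. N *v v i = d i *s v i) \<and>
      (\<forall>i\<in>UNIV. \<forall>j\<in>UNIV. hinner (v i) (v j) = (if i = j then 1 else 0))"
    using normal_matrix_orthonormal_eigenvectors[OF assms, of UNIV] by (elim exE)
  have v: "N *v v i = d i *s v i" for i
    using vd by blast
  have orth: "hinner (v i) (v j) = (if i = j then 1 else 0)" for i j
    using vd by blast
  define V where "V = (\<chi> i j. v j $ i)"
  have "(conj_transpose V ** V) $ i $ j = hinner (v j) (v i)" for i j
    by (simp add: V_def conj_transpose_def matrix_matrix_mult_def hinner_def mult.commute)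
  then have V: "unitary V"
    by (simp add: unitary_def vec_eq_iff orth mat_def)
  have "N ** V = V ** diag_matrix d"
    using v by (simp add: V_def diag_matrix_def vec_eq_iff matrix_matrix_mult_def matrix_vector_mult_def
        if_distrib if_distribR mult.commute cong: if_cong)
  then have "N = conj_diag V d"
    using unitary_cancel(2)[OF V, of N] by (simp add: conj_diag_def)
  with V show ?thesis by (rule that)
qed

section \<open>Unitary similarity of normal matrices with equal spectra\<close>

text \<open>
  The characteristic polynomial is \<open>\<Prod>i. x - d i\<close>: for every number \<open>x\<close>, also
  \<open>mat x - conj_diag V d\<close> is diagonalized by \<open>V\<close>, with eigenvalues \<open>x - d i\<close>.
\<close>

lemma eigenvalues_conj_diag:
  assumes "unitary V"
  shows "eigenvalues (conj_diag V d) = image_mset d (mset_set UNIV)"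
proof -
  have "poly (charpoly (conj_diag V d)) x = poly (\<Prod>i\<in>UNIV. [:- d i, 1:]) x" for x
  proof -
    have "mat x = conj_diag V (\<lambda>_. x)"
      using conj_diag_one[OF assms]
      by (simp add: vec_eq_iff conj_diag_entry mat_def mult_ac flip: sum_distrib_left)
    then have "mat x - conj_diag V d = conj_diag V (\<lambda>i. x - d i)"
      by (simp add: vec_eq_iff conj_diag_entry algebra_simps sum_subtractf)
    then show ?thesis
      by (simp add: poly_charpoly det_conj_diag[OF assms] poly_prod)
  qed
  then have "charpoly (conj_diag V d) = (\<Prod>i\<in>UNIV. [:- d i, 1:])"
    by (simp add: poly_eq_poly_eq_iff[symmetric] fun_eq_iff)
  then have "eigenvalues (conj_diag V d) = (\<Sum>i\<in>UNIV. {#d i#})"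
    by (simp add: eigenvalues_def proots_prod)
  then show ?thesis
    by (simp add: sum_unfold_sum_mset)
qed

text \<open>
  Equal multisets of eigenvalues differ by a permutation of the index set. Permuting the columns of
  the eigenvector matrix of \<open>Y\<close> in the same way gives orthonormal bases \<open>V\<close> and \<open>W'\<close> in which \<open>X\<close>
  and \<open>Y\<close> are the same diagonal matrix; the change of basis \<open>W' V\<^sup>*\<close> conjugates \<open>X\<close> to \<open>Y\<close>.
\<close>

lemma normal_matrices_unitarily_similar:
  assumes "normal_matrix X" "normal_matrix Y" "eigenvalues X = eigenvalues Y"
  obtains U where "unitary U" "Y = U ** X ** conj_transpose U"
proof -
  obtain V d where V: "unitary V" "X = conj_diag V d"
    using normal_matrix_unitarily_diagonalizable[OF assms(1)] .
  obtain W e where W: "unitary W" "Y = conj_diag W e"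
    using normal_matrix_unitarily_diagonalizable[OF assms(2)] .
  have "image_mset e (mset_set UNIV) = image_mset d (mset_set UNIV)"
    using assms(3) by (simp add: V W eigenvalues_conj_diag)
  then obtain p where p: "p permutes UNIV" and pd: "\<And>i. e i = d (p i)"
    using image_mset_eq_implies_permutes[OF finite] by (metis UNIV_I)
  define W' where "W' = (\<chi> i j. W $ i $ Hilbert_Choice.inv p j)"
  note perm = sum.permute[OF permutes_inv[OF p], unfolded o_def]
  have "conj_diag W' f = conj_diag W (\<lambda>i. f (p i))" for f
    unfolding vec_eq_iff conj_diag_entry
    by (subst (2) perm) (simp add: W'_def permutes_inverses[OF p])
  note W' = this
  then have "conj_diag W' (\<lambda>_. 1) = mat 1"
    by (simp add: conj_diag_one[OF W(1)])
  then have "W' ** conj_transpose W' = mat 1"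
    by (simp add: vec_eq_iff conj_diag_entry) (simp add: matrix_matrix_mult_def conj_transpose_def)
  then have uW': "unitary W'"
    by (simp add: unitary_def matrix_left_right_inverse)
  show ?thesis
  proof
    show "unitary (W' ** conj_transpose V)"
      by (intro unitary_mult unitary_conj_transpose uW' V)
    show "Y = W' ** conj_transpose V ** X ** conj_transpose (W' ** conj_transpose V)"
      by (simp add: V(2) conj_diag_conjugate unitary_cancel[OF V(1)] W' W(2) flip: pd)
  qed
qed

section \<open>Exponentials of diagonalized matrices\<close>

lemma sums_matrixI:
  fixes f :: "nat \<Rightarrow> complex ^ 'n ^ 'm"
  assumes "\<And>i j. (\<lambda>k. f k $ i $ j) sums (S $ i $ j)"
  shows "f sums S"
  using assms unfolding sums_def by (intro vec_tendstoI) simp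

lemma scaleR_conj_diag: "t *\<^sub>R conj_diag V d = conj_diag V (\<lambda>i. of_real t * d i)"
  by (simp add: vec_eq_iff conj_diag_entry scaleR_sum_right)
    (simp add: scaleR_conv_of_real mult_ac)

lemma mat_power_conj_diag:
  assumes "unitary V"
  shows "mat_power (conj_diag V d) k = conj_diag V (\<lambda>i. d i ^ k)"
  by (induction k) (simp_all add: conj_diag_one[OF assms] conj_diag_mult[OF assms])

lemma mat_exp_conj_diag:
  assumes "unitary V"
  shows "mat_exp (conj_diag V d) = conj_diag V (\<lambda>i. exp (d i))"
proof -
  have "(\<lambda>k. (1 / fact k :: real) *\<^sub>R mat_power (conj_diag V d) k) sums conj_diag V (\<lambda>i. exp (d i))"
  proof (rule sums_matrixI)
    fix i j
    have "(\<lambda>k. \<Sum>l\<in>UNIV. V $ i $ l * (d l ^ k /\<^sub>R fact k) * cnj (V $ j $ l)) sums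
          (\<Sum>l\<in>UNIV. V $ i $ l * exp (d l) * cnj (V $ j $ l))"
      by (intro sums_sum sums_mult sums_mult2 exp_converges)
    then show "(\<lambda>k. ((1 / fact k :: real) *\<^sub>R mat_power (conj_diag V d) k) $ i $ j) sums
          conj_diag V (\<lambda>i. exp (d i)) $ i $ j"
      by (simp add: mat_power_conj_diag[OF assms] conj_diag_entry scaleR_sum_right inverse_eq_divide)
  qed
  then show ?thesis
    unfolding mat_exp_def by (rule sums_unique[symmetric])
qed

lemma one_param_conjugate:
  assumes "unitary U" "normal_matrix X"
  shows "one_param (U ** X ** conj_transpose U) t = U ** one_param X t ** conj_transpose U"
proof -
  obtain V d where V: "unitary V" and X: "X = conj_diag V d"
    using normal_matrix_unitarily_diagonalizable[OF assms(2)] .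
  have one_param: "one_param (conj_diag W d) t = conj_diag W (\<lambda>i. exp (of_real t * d i))"
    if "unitary W" for W
    unfolding one_param_def scaleR_conj_diag by (rule mat_exp_conj_diag[OF that])
  show ?thesis
    by (simp add: X conj_diag_conjugate one_param V unitary_mult[OF assms(1)])
qed

text \<open>
  A skew-Hermitian matrix has imaginary eigenvalues \<open>\<i> \<theta> i\<close>, so its one-parameter subgroup
  rotates each eigenvector with the constant speed \<open>\<theta> i\<close>; the speeds add up to zero because the
  trace does.
\<close>

lemma su_one_param_diagonal:
  assumes "X \<in> su"
  obtains V \<theta> where "unitary V" "sum \<theta> UNIV = 0"
    "\<And>t. one_param X t = conj_diag V (\<lambda>i. cis (t * \<theta> i))"
proof -
  have X: "conj_transpose X = - X" "trace X = 0"
    using assms by (auto simp: su_def)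
  obtain V d where V: "unitary V" and Xd: "X = conj_diag V d"
    using normal_matrix_unitarily_diagonalizable[OF skew_hermitian_imp_normal[OF X(1)]] .
  have "conj_diag V (\<lambda>i. cnj (d i)) = conj_diag V (\<lambda>i. - d i)"
    using X(1) unfolding Xd conj_transpose_conj_diag
    by (simp add: vec_eq_iff conj_diag_entry sum_negf)
  then have cnj_d: "cnj (d i) = - d i" for i
    by (simp add: conj_diag_inject[OF V] fun_eq_iff)
  have d: "d i = \<i> * of_real (Im (d i))" for i
    using cnj_d[of i] by (simp add: complex_eq_iff)
  have "(\<Sum>i\<in>UNIV. d i) = 0"
    using X(2) unfolding Xd trace_conj_diag[OF V] .
  then have "(\<Sum>i\<in>UNIV. Im (d i)) = 0"
    by (simp flip: Im_sum)
  moreover have "one_param X t = conj_diag V (\<lambda>i. cis (t * Im (d i)))" for t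
  proof -
    have "t *\<^sub>R X = conj_diag V (\<lambda>i. of_real t * d i)"
      by (simp add: Xd scaleR_conj_diag)
    moreover have "exp (of_real t * d i) = cis (t * Im (d i))" for i
      by (subst d) (simp add: cis_conv_exp mult_ac)
    ultimately show ?thesis
      by (simp add: one_param_def mat_exp_conj_diag[OF V])
  qed
  ultimately show ?thesis
    using V that by blast
qed

lemma conj_diag_cis_in_SU:
  assumes "unitary V" "sum \<theta> UNIV = 0"
  shows "conj_diag V (\<lambda>i. cis (t * \<theta> i)) \<in> carrier SU"
proof -
  have "(\<Prod>i\<in>UNIV. cis (t * \<theta> i)) = exp (\<Sum>i\<in>UNIV. \<i> * of_real (t * \<theta> i))"
    by (simp add: cis_conv_exp exp_sum)
  also have "(\<Sum>i\<in>UNIV. \<i> * of_real (t * \<theta> i)) = \<i> * of_real (t * sum \<theta> UNIV)"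
    by (simp add: sum_distrib_left)
  finally have "det (conj_diag V (\<lambda>i. cis (t * \<theta> i))) = 1"
    by (simp add: det_conj_diag[OF assms(1)] assms(2))
  then show ?thesis
    using unitary_conj_diag[OF assms(1)] by (simp add: SU_def unitary_def)
qed

section \<open>Discrete subgroups of the reals and periods\<close>

text \<open>
  The gap \<open>\<delta>\<close> around zero makes the subgroup discrete, so it has a least positive element \<open>\<tau>\<close>.
  Any element minus the multiple of \<open>\<tau>\<close> below it is an element in \<open>[0, \<tau>)\<close>, hence zero.
\<close>

lemma discrete_real_subgroup_cyclic:
  fixes K :: "real set"
  assumes diff: "\<And>a b. a \<in> K \<Longrightarrow> b \<in> K \<Longrightarrow> a - b \<in> K"
    and \<delta>: "\<delta> > 0" "\<And>a. a \<in> K \<Longrightarrow> a \<noteq> 0 \<Longrightarrow> \<delta> \<le> \<bar>a\<bar>"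
    and a0: "a0 \<in> K" "a0 \<noteq> 0"
  shows "\<exists>\<tau>>0. K = range (\<lambda>k::int. \<tau> * of_int k)"
proof -
  have zero: "0 \<in> K" using diff[OF a0(1) a0(1)] by simp
  then have minus: "- a \<in> K" if "a \<in> K" for a using diff[OF zero that] by simp
  have add: "a + b \<in> K" if "a \<in> K" "b \<in> K" for a b using diff[OF that(1) minus[OF that(2)]] by simp
  have nat_mult: "of_nat n * a \<in> K" if "a \<in> K" for n a
    by (induction n) (simp_all add: zero add that distrib_right)
  have int_mult: "of_int k * a \<in> K" if "a \<in> K" for k a
    using nat_mult[OF that, of "nat \<bar>k\<bar>"] minus[OF nat_mult[OF that, of "nat \<bar>k\<bar>"]]
    by (cases "k \<ge> 0") auto
  define P where "P n \<longleftrightarrow> (\<exists>t\<in>K. 0 < t \<and> t < real n * \<delta>)" for n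
  have "\<bar>a0\<bar> \<in> K" using a0 minus by (simp add: abs_if)
  moreover obtain n where "\<bar>a0\<bar> < real n * \<delta>" using reals_Archimedean3[OF \<delta>(1)] by blast
  ultimately have "P n" using a0(2) unfolding P_def by (intro bexI[of _ "\<bar>a0\<bar>"]) auto
  \<comment> \<open>A positive element \<open>\<tau>\<close> in the first nonempty slice \<open>[(m - 1) \<delta>, m \<delta>)\<close> is the least
    positive one: a smaller one would lie in the same slice, at a distance less than \<open>\<delta>\<close>.\<close>
  define m where "m = (LEAST n. P n)"
  have "P m" unfolding m_def using \<open>P n\<close> by (rule LeastI)
  then obtain \<tau> where \<tau>: "\<tau> \<in> K" "0 < \<tau>" "\<tau> < real m * \<delta>" by (auto simp: P_def)
  have "m > 0" using \<tau> by (cases m) auto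
  have least: "\<tau> \<le> s" if "s \<in> K" "0 < s" for s
  proof (rule ccontr)
    assume "\<not> \<tau> \<le> s"
    then have "\<delta> \<le> \<tau> - s"
      using \<delta>(2)[OF diff[OF \<tau>(1) that(1)]] by auto
    then have "s < real (m - 1) * \<delta>"
      using \<tau>(3) \<open>m > 0\<close> by (simp add: of_nat_diff algebra_simps)
    then have "P (m - 1)" using that unfolding P_def by blast
    then have "m \<le> m - 1" unfolding m_def by (rule Least_le)
    then show False using \<open>m > 0\<close> by simp
  qed
  have "K = range (\<lambda>k::int. \<tau> * of_int k)"
  proof (intro equalityI subsetI)
    fix s assume s: "s \<in> K"
    define r where "r = s - of_int \<lfloor>s / \<tau>\<rfloor> * \<tau>"
    have "of_int \<lfloor>s / \<tau>\<rfloor> * \<tau> \<le> s"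
      using of_int_floor_le[of "s / \<tau>"] pos_le_divide_eq[OF \<tau>(2)] by blast
    then have "0 \<le> r" by (simp add: r_def)
    moreover have "s / \<tau> < of_int \<lfloor>s / \<tau>\<rfloor> + 1" by linarith
    then have "r < \<tau>" using \<tau>(2) by (simp add: r_def field_simps)
    moreover have "r \<in> K" unfolding r_def by (intro diff s int_mult \<tau>)
    ultimately have "r = 0" using least[of r] by fastforce
    then have "s = \<tau> * of_int \<lfloor>s / \<tau>\<rfloor>"
      unfolding r_def by (metis eq_iff_diff_eq_0 mult.commute)
    then show "s \<in> range (\<lambda>k::int. \<tau> * of_int k)" by blast
  next
    fix s assume "s \<in> range (\<lambda>k::int. \<tau> * of_int k)"
    then show "s \<in> K" using int_mult[OF \<tau>(1)] by (auto simp: mult.commute)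
  qed
  with \<tau>(2) show ?thesis by blast
qed

lemma positive_generator_unique:
  fixes \<sigma> \<tau> :: real
  assumes "\<sigma> > 0" "\<tau> > 0" "range (\<lambda>k::int. \<sigma> * of_int k) = range (\<lambda>k::int. \<tau> * of_int k)"
  shows "\<sigma> = \<tau>"
proof -
  have le: "\<tau> \<le> \<sigma>"
    if pos: "\<sigma> > 0" "\<tau> > 0"
      and eq: "range (\<lambda>k::int. \<sigma> * of_int k) = range (\<lambda>k::int. \<tau> * of_int k)" for \<sigma> \<tau> :: real
  proof -
    have "\<sigma> * of_int 1 \<in> range (\<lambda>k::int. \<tau> * of_int k)"
      unfolding eq[symmetric] by blast
    then obtain k :: int where k: "\<sigma> = \<tau> * of_int k" by auto
    then have "k > 0" using pos by (simp add: zero_less_mult_iff)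
    then have "\<tau> * 1 \<le> \<tau> * of_int k" using pos by (intro mult_left_mono) auto
    then show ?thesis using k by simp
  qed
  show ?thesis using le[OF assms] le[OF assms(2,1) assms(3)[symmetric]] by simp
qed

lemma cis_eq_one_iff: "cis a = 1 \<longleftrightarrow> (\<exists>k::int. a = 2 * pi * of_int k)"
  using exp_eq_1[of "\<i> * of_real a"] by (auto simp: cis_conv_exp mult_ac)

text \<open>
  This justifies the definite description in the definition of \<^const>\<open>period\<close>. The kernel is
  discrete: some speed \<open>\<theta> j\<close> is nonzero, and already the rotation of the \<open>j\<close>-th eigenvector
  needs the time \<open>2 * pi / \<bar>\<theta> j\<bar>\<close> to close up.
\<close>

lemma period_kernel:
  assumes X: "X \<in> su" "generates_knotted_subgroup X"
  shows "period X > 0" "{t. one_param X t = mat 1} = range (\<lambda>k::int. period X * of_int k)"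
proof -
  obtain V \<theta> where V: "unitary V"
    and one_param: "\<And>t. one_param X t = conj_diag V (\<lambda>i. cis (t * \<theta> i))"
    using su_one_param_diagonal[OF X(1)] by metis
  define K where "K = {t. one_param X t = mat 1}"
  have K_iff: "t \<in> K \<longleftrightarrow> (\<forall>i. cis (t * \<theta> i) = 1)" for t
    by (simp add: K_def one_param conj_diag_eq_one_iff[OF V])
  have K_diff: "s - t \<in> K \<longleftrightarrow> one_param X s = one_param X t" for s t
    by (simp add: K_iff one_param conj_diag_inject[OF V] fun_eq_iff left_diff_distrib flip: cis_divide)
  obtain t1 where "t1 \<notin> K"
    using X(2) by (auto simp: K_def generates_knotted_subgroup_def)
  then obtain j where "cis (t1 * \<theta> j) \<noteq> 1" by (auto simp: K_iff)
  then have "\<theta> j \<noteq> 0" by auto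
  have "\<exists>\<tau>>0. K = range (\<lambda>k::int. \<tau> * of_int k)"
  proof -
    obtain s t where "s \<noteq> t" "one_param X s = one_param X t"
      using X(2) by (auto simp: generates_knotted_subgroup_def inj_def)
    then have "s - t \<in> K" "s - t \<noteq> 0" by (simp_all add: K_diff)
    moreover have "a - b \<in> K" if "a \<in> K" "b \<in> K" for a b
      using that unfolding K_diff by (simp add: K_def)
    moreover have "2 * pi / \<bar>\<theta> j\<bar> \<le> \<bar>a\<bar>" if "a \<in> K" "a \<noteq> 0" for a
    proof -
      obtain k :: int where k: "a * \<theta> j = 2 * pi * of_int k"
        using \<open>a \<in> K\<close> by (auto simp: K_iff cis_eq_one_iff)
      then have "k \<noteq> 0" using \<open>a \<noteq> 0\<close> \<open>\<theta> j \<noteq> 0\<close> by auto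
      then have "2 * pi * 1 \<le> 2 * pi * \<bar>of_int k :: real\<bar>" by (intro mult_left_mono) auto
      also have "\<dots> = \<bar>a\<bar> * \<bar>\<theta> j\<bar>" by (simp add: k flip: abs_mult) (simp add: abs_mult)
      finally show ?thesis using \<open>\<theta> j \<noteq> 0\<close> by (simp add: field_simps)
    qed
    moreover have "2 * pi / \<bar>\<theta> j\<bar> > 0" using \<open>\<theta> j \<noteq> 0\<close> by simp
    ultimately show ?thesis
      using discrete_real_subgroup_cyclic[of K "2 * pi / \<bar>\<theta> j\<bar>" "s - t"] by blast
  qed
  then have "\<exists>!\<tau>. \<tau> > 0 \<and> K = range (\<lambda>k::int. \<tau> * of_int k)"
    using positive_generator_unique by blast
  from theI'[OF this] show "period X > 0" "{t. one_param X t = mat 1} = range (\<lambda>k::int. period X * of_int k)"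
    unfolding period_def K_def by auto
qed

section \<open>One-parameter subgroups that close up are knotted\<close>

lemma continuous_on_conj_diag:
  assumes "\<And>i. continuous_on S (\<lambda>x. f x i)"
  shows "continuous_on S (\<lambda>x. conj_diag V (f x))"
proof -
  have "conj_diag V (f x) = (\<chi> i j. \<Sum>l\<in>UNIV. V $ i $ l * f x l * cnj (V $ j $ l))" for x
    by (simp add: vec_eq_iff conj_diag_entry)
  then show ?thesis
    by (simp only:) (intro continuous_intros assms)
qed

lemma unit_circle_cis:
  assumes "z \<in> sphere 0 1"
  shows "z = cis (Arg2pi z)"
  using assms by (simp add: cis_conv_exp complex_norm_eq_1_exp)

text \<open>
  After the time \<^term>\<open>period X\<close> every eigenvector has made a whole number \<open>m i\<close> of turns. So
  the generated map sends \<open>z\<close> to the diagonal matrix of the powers \<open>z powi m i\<close> in a basis of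
  eigenvectors; in this form, without the jump of \<^const>\<open>Arg2pi\<close> at \<open>1\<close>, it is visibly a
  continuous homomorphism. It is injective because the kernel consists of the multiples of the
  period, and its inverse is continuous because the circle is compact.
\<close>

lemma generated_knotted_subgroup_knotted:
  assumes X: "X \<in> su" "generates_knotted_subgroup X"
  shows "knotted_subgroup SU (generated_knotted_subgroup X)"
proof -
  let ?\<gamma> = "generated_knotted_subgroup X" and ?S = "sphere 0 1 :: complex set"
  obtain V \<theta> where V: "unitary V" and \<theta>: "sum \<theta> UNIV = 0"
    and one_param: "\<And>t. one_param X t = conj_diag V (\<lambda>i. cis (t * \<theta> i))"
    using su_one_param_diagonal[OF X(1)] by blast
  note period = period_kernel[OF X]
  have "one_param X (period X * of_int 1) = mat 1"
    using period(2) by blast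
  then have "cis (period X * \<theta> i) = 1" for i
    by (simp add: one_param conj_diag_eq_one_iff[OF V])
  then obtain m :: "'a \<Rightarrow> int" where m: "\<And>i. period X * \<theta> i = 2 * pi * of_int (m i)"
    unfolding cis_eq_one_iff by metis
  have one_param_m: "one_param X (period X * a / (2 * pi)) = conj_diag V (\<lambda>i. cis a powi m i)" for a
  proof -
    have "period X * a / (2 * pi) * \<theta> i = of_int (m i) * a" for i
      using m[of i] by (simp add: field_simps)
    then show ?thesis by (simp add: one_param cis_power_int)
  qed
  have \<gamma>: "?\<gamma> z = conj_diag V (\<lambda>i. z powi m i)" if "z \<in> ?S" for z
    using that unit_circle_cis[OF that] by (simp add: generated_knotted_subgroup_def one_param_m)
  have \<gamma>_SU: "?\<gamma> z \<in> carrier SU" for z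
    unfolding generated_knotted_subgroup_def one_param by (rule conj_diag_cis_in_SU[OF V \<theta>])
  have hom: "?\<gamma> \<in> hom circle_group SU"
  proof (rule homI)
    fix z w assume "z \<in> carrier circle_group" "w \<in> carrier circle_group"
    then have "z \<in> ?S" "w \<in> ?S" by (simp_all add: circle_group_def)
    moreover from this have "z * w \<in> ?S" by (simp add: norm_mult)
    ultimately show "?\<gamma> (z \<otimes>\<^bsub>circle_group\<^esub> w) = ?\<gamma> z \<otimes>\<^bsub>SU\<^esub> ?\<gamma> w"
      by (simp add: circle_group_def SU_def \<gamma> conj_diag_mult[OF V] power_int_mult_distrib)
  qed (rule \<gamma>_SU)
  have cont: "continuous_on ?S ?\<gamma>"
  proof -
    have "continuous_on ?S (\<lambda>z. conj_diag V (\<lambda>i. z powi m i))"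
      by (intro continuous_on_conj_diag continuous_intros) auto
    then show ?thesis by (rule continuous_on_eq) (simp add: \<gamma>)
  qed
  have inj: "inj_on ?\<gamma> ?S"
  proof (rule inj_onI)
    fix z w assume zw: "z \<in> ?S" "w \<in> ?S" "?\<gamma> z = ?\<gamma> w"
    define a where "a = Arg2pi z - Arg2pi w"
    have a: "cis a = z / w"
      using unit_circle_cis[OF zw(1)] unit_circle_cis[OF zw(2)] by (simp add: a_def flip: cis_divide)
    have "z powi m i = w powi m i" for i
      using zw by (simp add: \<gamma> conj_diag_inject[OF V] fun_eq_iff)
    moreover have "w \<noteq> 0" using zw(2) by auto
    ultimately have "cis a powi m i = 1" for i
      by (simp add: a power_int_divide_distrib)
    then have "one_param X (period X * a / (2 * pi)) = mat 1"
      by (simp add: one_param_m conj_diag_one[OF V])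
    then obtain k :: int where "period X * a / (2 * pi) = period X * of_int k"
      using period(2) by blast
    then have "a = 2 * pi * of_int k"
      using period(1) by (simp add: field_simps)
    then have "cis a = 1" unfolding cis_eq_one_iff by blast
    then show "z = w" using a \<open>w \<noteq> 0\<close> by simp
  qed
  have "continuous_on (?\<gamma> ` ?S) (inv_into ?S ?\<gamma>)"
    using cont by (rule continuous_on_inv) (auto simp: inv_into_f_f[OF inj])
  with hom cont inj show ?thesis by (simp add: knotted_subgroup_def)
qed

section \<open>Conjugation by unitary matrices\<close>

lemma continuous_on_matrix_mult:
  fixes f :: "'a::topological_space \<Rightarrow> complex ^ 'n ^ 'm" and g :: "'a \<Rightarrow> complex ^ 'k ^ 'n"
  assumes "continuous_on S f" "continuous_on S g"
  shows "continuous_on S (\<lambda>x. f x ** g x)"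
  unfolding matrix_matrix_mult_def by (intro continuous_intros assms)

lemma unitary_conjugation_SU:
  assumes U: "unitary U" and A: "A \<in> carrier SU"
  shows "U ** A ** conj_transpose U \<in> carrier SU"
proof -
  have A: "unitary A" "det A = 1" using A by (simp_all add: SU_def unitary_def)
  have "unitary (U ** A ** conj_transpose U)"
    by (intro unitary_mult unitary_conj_transpose U A)
  moreover have "det U * det (conj_transpose U) = 1"
    using unitary_right[OF U] by (metis det_mul det_I)
  ultimately show ?thesis by (simp add: SU_def unitary_def det_mul A)
qed

lemma unitary_conjugation_homeomorphism_SU:
  assumes U: "unitary U"
  shows "homeomorphism (carrier SU) (carrier SU)
    (\<lambda>A. U ** A ** conj_transpose U) (\<lambda>A. conj_transpose U ** A ** U)"
proof (rule homeomorphismI)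
  show "(\<lambda>A. conj_transpose U ** A ** U) ` carrier SU \<subseteq> carrier SU"
    using unitary_conjugation_SU[OF unitary_conj_transpose[OF U]] by auto
  show "conj_transpose U ** (U ** A ** conj_transpose U) ** U = A" for A
    by (simp add: matrix_mul_assoc unitary_cancel[OF U] U[unfolded unitary_def])
  show "U ** (conj_transpose U ** A ** U) ** conj_transpose U = A" for A
    by (simp add: matrix_mul_assoc unitary_cancel[OF U] unitary_right[OF U])
qed (auto intro!: continuous_on_matrix_mult continuous_intros unitary_conjugation_SU[OF U])

lemma unitary_conjugation_iso_SU:
  assumes U: "unitary U"
  shows "(\<lambda>A. U ** A ** conj_transpose U) \<in> iso SU SU"
proof (rule isoI)
  have "U ** (A ** B) ** conj_transpose U
      = U ** A ** conj_transpose U ** (U ** B ** conj_transpose U)" for A B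
    by (simp add: matrix_mul_assoc unitary_cancel[OF U])
  then show "(\<lambda>A. U ** A ** conj_transpose U) \<in> hom SU SU"
    using unitary_conjugation_SU[OF U] by (auto intro!: homI simp: SU_def)
  have "inj_on (\<lambda>A. U ** A ** conj_transpose U) (carrier SU)"
    using homeomorphism_apply1[OF unitary_conjugation_homeomorphism_SU[OF U]]
    by (rule inj_on_inverseI)
  then show "bij_betw (\<lambda>A. U ** A ** conj_transpose U) (carrier SU) (carrier SU)"
    using homeomorphism_image1[OF unitary_conjugation_homeomorphism_SU[OF U]]
    by (simp add: bij_betw_def)
qed

text \<open>
  A unitary matrix is normal, and its eigenvalues lie on the unit circle. Shrinking their arguments
  linearly to zero, with fixed eigenvectors, joins the matrix to the identity inside the unitary
  group.
\<close>

lemma unitary_path_from_identity: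
  assumes "unitary U"
  obtains P where "\<And>t. unitary (P t)" "P 0 = mat 1" "P 1 = U" "continuous_on UNIV (P :: real \<Rightarrow> _)"
proof -
  obtain W u where W: "unitary W" and U: "U = conj_diag W u"
    using normal_matrix_unitarily_diagonalizable[OF unitary_imp_normal[OF assms]] .
  have "conj_diag W (\<lambda>i. cnj (u i) * u i) = conj_diag W (\<lambda>_. 1)"
    using assms by (simp add: unitary_def U conj_transpose_conj_diag conj_diag_mult[OF W] conj_diag_one[OF W])
  then have "cnj (u i) * u i = 1" for i
    unfolding conj_diag_inject[OF W] by metis
  then have "(norm (u i))\<^sup>2 = 1" for i
    using complex_norm_square[of "u i"] by (metis mult.commute of_real_eq_1_iff)
  then have "norm (u i) = 1" for i
    using power2_eq_iff_nonneg[of "norm (u i)" 1] by simp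
  then have u: "u i = cis (Arg2pi (u i))" for i
    by (intro unit_circle_cis) simp
  show ?thesis
  proof
    let ?P = "\<lambda>t. conj_diag W (\<lambda>i. cis (t * Arg2pi (u i)))"
    show "unitary (?P t)" for t by (intro unitary_conj_diag W) simp
    show "?P 0 = mat 1" by (simp add: conj_diag_one[OF W])
    show "?P 1 = U" using u by (simp add: U)
    show "continuous_on UNIV ?P" by (intro continuous_on_conj_diag continuous_intros)
  qed
qed

text \<open>
  Conjugation by the matrices on a path from the identity to \<open>U\<close> is the ambient automorphism.
  The path may leave the special unitary group, because any unitary matrix normalizes it.
\<close>

lemma ambient_automorphism_of_unitary_conjugation:
  assumes "unitary U" "\<And>z. z \<in> sphere 0 1 \<Longrightarrow> \<psi> z = U ** \<phi> z ** conj_transpose U"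
  shows "\<exists>F. ambient_automorphism SU F \<phi> \<psi>"
proof -
  obtain P where P: "\<And>t. unitary (P t)" "P 0 = mat 1" "P 1 = U" "continuous_on UNIV (P :: real \<Rightarrow> _)"
    using unitary_path_from_identity[OF assms(1)] by metis
  define F where "F = (\<lambda>(A, t). P t ** A ** conj_transpose (P t))"
  have P': "continuous_on (carrier SU \<times> {0..1}) (\<lambda>x. P (snd x))"
    by (rule continuous_on_compose2[OF P(4)]) (auto intro: continuous_intros)
  then have "continuous_on (carrier SU \<times> {0..1}) (\<lambda>x. conj_transpose (P (snd x)))"
    unfolding conj_transpose_def by (intro continuous_intros)
  with P' have "continuous_on (carrier SU \<times> {0..1}) F"
    unfolding F_def case_prod_beta by (intro continuous_on_matrix_mult continuous_intros)
  then have "ambient_automorphism SU F \<phi> \<psi>"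
    unfolding ambient_automorphism_def
    using unitary_conjugation_SU[OF P(1)] unitary_conjugation_homeomorphism_SU[OF P(1)]
      unitary_conjugation_iso_SU[OF P(1)]
    by (auto simp: F_def P(2,3) assms(2))
  then show ?thesis by blast
qed

theorem corollary6:
  fixes X Y :: "complex ^ 'n ^ 'n"
  assumes "CARD('n) \<ge> 2"
    and "X \<in> su" and "Y \<in> su"
    and "generates_knotted_subgroup X" and "generates_knotted_subgroup Y"
    and "eigenvalues X = eigenvalues Y"
  shows "ambient_automorphic SU (generated_knotted_subgroup X) (generated_knotted_subgroup Y)"
proof -
  have "normal_matrix X" "normal_matrix Y"
    using assms by (auto simp: su_def intro: skew_hermitian_imp_normal)
  then obtain U where U: "unitary U" "Y = U ** X ** conj_transpose U"
    using normal_matrices_unitarily_similar assms(6) by metis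
  have one_param: "one_param Y t = U ** one_param X t ** conj_transpose U" for t
    unfolding U(2) using U(1) \<open>normal_matrix X\<close> by (rule one_param_conjugate)
  have "one_param Y t = mat 1 \<longleftrightarrow> one_param X t = mat 1" for t
  proof
    assume "one_param Y t = mat 1"
    then have "conj_transpose U ** one_param Y t ** U = mat 1"
      using U(1) by (simp add: unitary_def)
    then show "one_param X t = mat 1"
      by (simp add: one_param matrix_mul_assoc unitary_cancel[OF U(1)] U(1)[unfolded unitary_def])
  qed (simp add: one_param unitary_right[OF U(1)])
  then have "period Y = period X"
    by (simp add: period_def)
  then have "generated_knotted_subgroup Y z = U ** generated_knotted_subgroup X z ** conj_transpose U" for z
    by (simp add: generated_knotted_subgroup_def one_param)
  then have "\<exists>F. ambient_automorphism SU F (generated_knotted_subgroup X) (generated_knotted_subgroup Y)"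
    using U(1) by (intro ambient_automorphism_of_unitary_conjugation)
  then show ?thesis
    using assms by (simp add: ambient_automorphic_def generated_knotted_subgroup_knotted)
qed

end
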